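(* Let $m$ be a positive odd integer and let $0<\alpha\leq\beta$ be real numbers. Define $$V(t)=\frac{\psi^{(m)}(\alpha+t)}{\psi^{(m)}(\beta+t)},\qquad t\in[0,\infty).$$ Then $V$ is decreasing (in the weak sense, i.e. non-increasing) on $[0,\infty)$, and for every $t\in[0,1]$, $$\frac{\psi^{(m)}(\alpha)}{\psi^{(m)}(\beta)}\geq\frac{\psi^{(m)}(\alpha+t)}{\psi^{(m)}(\beta+t)}\geq\frac{\psi^{(m)}(\alpha+1)}{\psi^{(m)}(\beta+1)}.$$
   Context: For $t>0$, $\Gamma(t)=\int_0^\infty e^{-x}x^{t-1}\,dx$ is the classical Gamma function, $\psi(t)=\frac{d}{dt}\ln\Gamma(t)=\Gamma'(t)/\Gamma(t)$ is the psi (digamma) function, and for a positive integer $m$ the polygamma function $\psi^{(m)}(t)=\frac{d^m}{dt^m}\psi(t)$ is its $m$-th derivative. *)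

theory Defs
  imports "HOL-Analysis.Analysis"
begin

text \<open>
  The library defines \<^const>\<open>Polygamma\<close> by its series expansion. On the positive reals,
  \<^term>\<open>Polygamma m\<close> is the \<open>m\<close>-th derivative of \<open>\<psi>\<close>, the logarithmic derivative of the
  Gamma function; the library theorem \<open>Gamma_integral_real\<close> gives the Euler integral
  for \<^const>\<open>Gamma\<close>.
\<close>

lemma Digamma_eq_deriv_ln_Gamma:
  fixes t :: real
  assumes "t > 0"
  shows "Digamma t = deriv (\<lambda>x. ln (Gamma x)) t"
    and "Digamma t = deriv Gamma t / Gamma t"
proof -
  have "eventually (\<lambda>x. ln (Gamma x) = ln_Gamma x) (nhds t)"
    using eventually_nhds_in_open[of "{0<..}" t] assms
    by (auto elim!: eventually_mono simp: ln_Gamma_real_pos)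
  then have "deriv (\<lambda>x. ln (Gamma x)) t = deriv ln_Gamma t"
    by (intro deriv_cong_ev refl)
  then show "Digamma t = deriv (\<lambda>x. ln (Gamma x)) t"
    using assms by (simp add: deriv_ln_Gamma_real)
  have "t \<notin> \<int>\<^sub>\<le>\<^sub>0"
    using assms by (auto elim!: nonpos_Ints_cases)
  then have "deriv Gamma t = Gamma t * Digamma t"
    by (intro DERIV_imp_deriv has_field_derivative_Gamma)
  then show "Digamma t = deriv Gamma t / Gamma t"
    using Gamma_real_pos[OF assms] by simp
qed

lemma Polygamma_eq_higher_deriv:
  fixes t :: real
  assumes "t > 0"
  shows "Polygamma m t = (deriv ^^ m) (\<lambda>x. deriv Gamma x / Gamma x) t"
proof -
  have "eventually (\<lambda>x. deriv Gamma x / Gamma x = Digamma x) (nhds t)"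
    using eventually_nhds_in_open[of "{0<..}" t] assms
    by (auto elim!: eventually_mono simp: Digamma_eq_deriv_ln_Gamma(2))
  then have "(deriv ^^ m) (\<lambda>x. deriv Gamma x / Gamma x) t = (deriv ^^ m) Digamma t"
    by (intro higher_deriv_cong_ev refl)
  also have "\<dots> = Polygamma m t"
    using assms by (subst higher_deriv_Polygamma) (auto elim!: nonpos_Ints_cases)
  finally show ?thesis ..
qed

end

theory Submission
  imports Defs
begin

text \<open>
  The monotonicity is log-convexity of \<open>f = \<psi>\<^sup>(\<^sup>m\<^sup>)\<close>, in the form \<open>f b * f c \<le> f a * f d\<close> whenever
  \<open>a \<le> b \<le> d\<close> and \<open>b + c = a + d\<close>. Up to the factor \<open>m!\<close>, \<open>f\<close> is a sum of the log-convex functions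
  \<open>(x + k) powr -(m + 1)\<close>. A positive function \<open>f\<close> is log-convex iff \<open>exp (c * x) * f x\<close> is
  convex for every real \<open>c\<close>, and this criterion passes to sums.
\<close>

lemma convex_on_cong:
  assumes "\<And>x. x \<in> S \<Longrightarrow> f x = g x"
  shows "convex_on S f \<longleftrightarrow> convex_on S g"
  using assms unfolding convex_on_def convex_def by (intro conj_cong ball_cong) auto

text \<open>The convexity inequality holds for each term, and summability at the three points
  involved lets it be summed over \<open>k\<close>.\<close>

lemma convex_on_suminf:
  fixes f :: "nat \<Rightarrow> 'a::real_vector \<Rightarrow> real"
  assumes "convex S"
    and conv: "\<And>k. convex_on S (f k)"
    and summ: "\<And>x. x \<in> S \<Longrightarrow> summable (\<lambda>k. f k x)"
  shows "convex_on S (\<lambda>x. \<Sum>k. f k x)"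
proof (rule convex_onI)
  fix t :: real and x y :: "'a"
  assume t: "0 < t" "t < 1" and xy: "x \<in> S" "y \<in> S"
  have mem: "(1 - t) *\<^sub>R x + t *\<^sub>R y \<in> S"
    using \<open>convex S\<close> t xy by (intro convexD) auto
  have "(\<Sum>k. f k ((1 - t) *\<^sub>R x + t *\<^sub>R y)) \<le> (\<Sum>k. (1 - t) * f k x + t * f k y)"
    using t xy by (intro suminf_le summable_add summable_mult summ mem convex_onD[OF conv]) auto
  also have "\<dots> = (1 - t) * (\<Sum>k. f k x) + t * (\<Sum>k. f k y)"
    using xy by (simp add: suminf_add[symmetric] suminf_mult summable_mult summ)
  finally show "(\<Sum>k. f k ((1 - t) *\<^sub>R x + t *\<^sub>R y)) \<le> (1 - t) * (\<Sum>k. f k x) + t * (\<Sum>k. f k y)" .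
qed (fact \<open>convex S\<close>)

text \<open>Monotonicity of \<open>exp\<close> carries over the inequality for \<open>f\<close>;
  convexity of \<open>exp\<close> then splits the result.\<close>

lemma convex_on_exp_compose:
  fixes f :: "'a::real_vector \<Rightarrow> real"
  assumes f: "convex_on S f"
  shows "convex_on S (\<lambda>x. exp (f x))"
proof (rule convex_onI)
  fix t :: real and x y :: "'a"
  assume t: "0 < t" "t < 1" and xy: "x \<in> S" "y \<in> S"
  have "exp (f ((1 - t) *\<^sub>R x + t *\<^sub>R y)) \<le> exp ((1 - t) * f x + t * f y)"
    using convex_onD[OF f, of t x y] t xy by simp
  also have "\<dots> \<le> (1 - t) * exp (f x) + t * exp (f y)"
    using convex_onD[OF exp_convex, of t "f x" "f y"] t by simp
  finally show "exp (f ((1 - t) *\<^sub>R x + t *\<^sub>R y)) \<le> (1 - t) * exp (f x) + t * exp (f y)" .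
qed (use f in \<open>auto simp: convex_on_def\<close>)

text \<open>The function is the exponential of \<open>c * x - p * ln (x + r)\<close>, whose
  derivative \<open>c - p / (x + r)\<close> is nondecreasing.\<close>

lemma convex_on_exp_mult_inverse_power:
  fixes c r :: real
  assumes "r \<ge> 0"
  shows "convex_on {0<..} (\<lambda>x. exp (c * x) * inverse ((x + r) ^ p))"
proof -
  have "convex_on {0<..} (\<lambda>x. c * x - real p * ln (x + r))"
  proof (rule convex_on_realI)
    show "((\<lambda>x. c * x - real p * ln (x + r)) has_real_derivative c - real p / (x + r)) (at x)"
      if "x \<in> {0<..}" for x
      using that assms by (auto intro!: derivative_eq_intros)
    show "c - real p / (x + r) \<le> c - real p / (y + r)" if "x \<in> {0<..}" "x \<le> y" for x y
      using that assms by (auto intro!: divide_left_mono)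
  qed auto
  then have "convex_on {0<..} (\<lambda>x. exp (c * x - real p * ln (x + r)))"
    by (rule convex_on_exp_compose)
  moreover have "exp (c * x - real p * ln (x + r)) = exp (c * x) * inverse ((x + r) ^ p)"
    if "x \<in> {0<..}" for x
    using that assms by (simp add: exp_diff exp_of_nat_mult divide_inverse)
  ultimately show ?thesis
    by (rule convex_on_cong[THEN iffD1, rotated])
qed

text \<open>For odd \<open>m\<close> the sign \<open>(-1) ^ Suc m\<close> in the series of
  \<open>Polygamma m\<close> is 1, so all terms enter with a positive coefficient and convexity can
  pass to the sum.\<close>

lemma Polygamma_odd_eq_suminf:
  fixes x :: real
  assumes "odd m" "x > 0"
  shows "summable (\<lambda>k. inverse ((x + real k) ^ Suc m))"
    and "Polygamma m x = fact m * (\<Sum>k. inverse ((x + real k) ^ Suc m))"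
  using Polygamma_LIMSEQ[of x m] assms odd_pos[OF assms(1)] by (auto simp: sums_iff)

lemma convex_on_exp_mult_Polygamma:
  fixes c :: real
  assumes "odd m"
  shows "convex_on {0<..} (\<lambda>x. exp (c * x) * Polygamma m x)"
proof -
  have "convex_on {0<..} (\<lambda>x. fact m * (\<Sum>k. exp (c * x) * inverse ((x + real k) ^ Suc m)))"
    using assms
    by (intro convex_on_cmul convex_on_suminf convex_on_exp_mult_inverse_power
        summable_mult Polygamma_odd_eq_suminf(1)) auto
  \<comment> \<open>The factor \<open>exp (c * x)\<close> is the same in all terms, so it can be
    pulled out of the series.\<close>
  moreover have "fact m * (\<Sum>k. exp (c * x) * inverse ((x + real k) ^ Suc m)) =
      exp (c * x) * Polygamma m x" if "x \<in> {0<..}" for x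
    using that assms
    by (subst suminf_mult) (auto simp: Polygamma_odd_eq_suminf simp del: power_Suc)
  ultimately show ?thesis
    by (rule convex_on_cong[THEN iffD1, rotated])
qed

text \<open>A suitable exponential tilt \<open>F\<close> of \<open>f\<close> has equal values at
  \<open>a\<close> and \<open>d\<close>. By convexity that common value bounds \<open>F\<close> on
  the whole interval, in particular at \<open>b\<close> and at its mirror point
  \<open>a + d - b\<close>.\<close>

lemma mult_le_mult_if_exp_mult_convex:
  fixes f :: "real \<Rightarrow> real"
  assumes conv: "\<And>c. convex_on S (\<lambda>x. exp (c * x) * f x)"
    and pos: "\<And>x. x \<in> S \<Longrightarrow> f x > 0"
    and S: "a \<in> S" "d \<in> S"
    and ord: "a \<le> b" "b \<le> d"
  shows "f b * f (a + d - b) \<le> f a * f d"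
proof (cases "a = d")
  case False
  \<comment> \<open>This \<open>c\<close> is the solution of
    \<open>exp (c * a) * f a = exp (c * d) * f d\<close>.\<close>
  define c where "c = (ln (f a) - ln (f d)) / (d - a)"
  define F where "F x = exp (c * x) * f x" for x
  have "c * (d - a) = ln (f a) - ln (f d)"
    using False by (simp add: c_def)
  then have "c * d + ln (f d) = c * a + ln (f a)"
    by (simp add: algebra_simps)
  then have "exp (c * d + ln (f d)) = exp (c * a + ln (f a))"
    by simp
  then have Fd: "F d = F a"
    using pos S by (simp add: F_def exp_add)
  have le: "F x \<le> F a \<and> x \<in> S" if "a \<le> x" "x \<le> d" for x
  proof -
    define t where "t = (x - a) / (d - a)"
    have t: "0 \<le> t" "t \<le> 1"
      using that False by (auto simp: t_def field_simps)
    have "t * (d - a) = x - a"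
      using False by (simp add: t_def)
    then have x: "x = (1 - t) *\<^sub>R a + t *\<^sub>R d"
      by (simp add: algebra_simps)
    have "F x \<le> (1 - t) * F a + t * F d"
      unfolding x F_def using S t by (intro convex_onD[OF conv])
    moreover have "x \<in> S"
      unfolding x using conv S t by (intro convexD) (auto simp: convex_on_def)
    ultimately show ?thesis
      by (simp add: Fd algebra_simps)
  qed
  have "F b * F (a + d - b) \<le> F a * F d"
    unfolding Fd using le[of b] le[of "a + d - b"] ord pos
    by (intro mult_mono) (auto simp: F_def less_imp_le S)
  \<comment> \<open>The exponential factor depends only on \<open>x + y\<close>. Both pairs of
    points have sum \<open>a + d\<close>, so it cancels.\<close>
  moreover have "F x * F y = exp (c * (x + y)) * (f x * f y)" for x y
    by (simp add: F_def algebra_simps exp_add)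
  ultimately show ?thesis
    by simp
qed (use ord in auto)

lemma Polygamma_ratio_antimono:
  fixes \<alpha> \<beta> s t :: real
  assumes "odd m" "0 < \<alpha>" "\<alpha> \<le> \<beta>" "0 \<le> s" "s \<le> t"
  shows "Polygamma m (\<alpha> + t) / Polygamma m (\<beta> + t) \<le> Polygamma m (\<alpha> + s) / Polygamma m (\<beta> + s)"
proof -
  have pos: "Polygamma m x > 0" if "x \<in> {0<..}" for x :: real
    using that assms by (intro Polygamma_real_odd_pos) (auto elim!: nonpos_Ints_cases)
  \<comment> \<open>The outer points are \<alpha> + s and \<beta> + t, the inner ones \<alpha> + t
    and \<beta> + s. This is the claim with denominators cleared.\<close>
  have "Polygamma m (\<alpha> + t) * Polygamma m ((\<alpha> + s) + (\<beta> + t) - (\<alpha> + t)) \<le>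
      Polygamma m (\<alpha> + s) * Polygamma m (\<beta> + t)"
    using assms
    by (intro mult_le_mult_if_exp_mult_convex[OF convex_on_exp_mult_Polygamma pos]) auto
  moreover have "(\<alpha> + s) + (\<beta> + t) - (\<alpha> + t) = \<beta> + s"
    by simp
  ultimately show ?thesis
    using pos[of "\<beta> + t"] pos[of "\<beta> + s"] assms by (simp add: field_simps)
qed

theorem theorem2p9:
  fixes m :: nat and \<alpha> \<beta> :: real and V :: "real \<Rightarrow> real"
  assumes "m > 0" and "odd m"
    and "0 < \<alpha>" and "\<alpha> \<le> \<beta>"
    and V_def: "\<And>t. t \<in> {0..} \<Longrightarrow> V t = Polygamma m (\<alpha> + t) / Polygamma m (\<beta> + t)"
  shows "antimono_on {0..} V \<and>
    (\<forall>t\<in>{0..1}.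
       Polygamma m \<alpha> / Polygamma m \<beta> \<ge> Polygamma m (\<alpha> + t) / Polygamma m (\<beta> + t) \<and>
       Polygamma m (\<alpha> + t) / Polygamma m (\<beta> + t) \<ge> Polygamma m (\<alpha> + 1) / Polygamma m (\<beta> + 1))"
proof -
  note anti = Polygamma_ratio_antimono[OF assms(2-4)]
  have "antimono_on {0..} V"
    by (intro monotone_onI) (simp add: V_def anti)
  then show ?thesis
    \<comment> \<open>Comparing \<open>t\<close> with the left end 0 gives the upper bound, with the
      right end 1 the lower bound.\<close>
    using anti[of 0] anti[of _ 1] by auto
qed

end
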